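(* Let $q_1,q_2\geq1$ be given coprime integers. Then, as $p\to\infty$ through primes, $$M_{q_1,q_2}(p)=\frac{\pi^2}{6q_1q_2}+O_{q_1,q_2}(1/p).$$
   Context: For a prime $p\geq3$, $X_p^-$ is the set of odd Dirichlet characters modulo $p$ (those with $\chi(-1)=-1$), $L(1,\chi)=\sum_{n\ge1}\chi(n)/n$, and $M_{q_1,q_2}(p)=\frac{2}{\phi(p)}\sum_{\chi\in X_p^-}\chi(q_1)\overline{\chi}(q_2)|L(1,\chi)|^2.$ *)

theory Defs
  imports Complex_Main "HOL-Number_Theory.Number_Theory" "HOL-Library.Landau_Symbols"
begin

(* Dirichlet characters are functions on the integers, extended by 0 to the integers
   that are not coprime to the modulus. *)
definition dirichlet_character :: "nat \<Rightarrow> (int \<Rightarrow> complex) \<Rightarrow> bool" where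
  "dirichlet_character m \<chi> \<longleftrightarrow>
     (\<forall>a. \<chi> (a + int m) = \<chi> a) \<and>
     (\<forall>a b. \<chi> (a * b) = \<chi> a * \<chi> b) \<and>
     (\<forall>a. \<chi> a \<noteq> 0 \<longleftrightarrow> coprime a (int m))"

definition odd_characters :: "nat \<Rightarrow> (int \<Rightarrow> complex) set" where
  "odd_characters m = {\<chi>. dirichlet_character m \<chi> \<and> \<chi> (-1) = -1}"

(* The series converges only conditionally; suminf is the limit of its partial sums in the
   natural order, and the index n stands for the integer n + 1. *)
definition L_one :: "(int \<Rightarrow> complex) \<Rightarrow> complex" where
  "L_one \<chi> = (\<Sum>n. \<chi> (int (Suc n)) / of_nat (Suc n))"

(* All summands together give a real number, but each one is complex, so the moment
   is kept as a complex number. *)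
definition twisted_moment :: "nat \<Rightarrow> nat \<Rightarrow> nat \<Rightarrow> complex" where
  "twisted_moment q1 q2 p =
     2 / of_nat (totient p) *
     (\<Sum>\<chi>\<in>odd_characters p.
        \<chi> (int q1) * cnj (\<chi> (int q2)) * of_real ((cmod (L_one \<chi>))\<^sup>2))"

end

theory Submission
  imports Defs "HOL-Analysis.Gamma_Function"
begin

text \<open>
  For odd \<open>\<chi>\<close> the partial sums of \<open>L(1, \<chi>)\<close> over full periods converge to digamma values, and
  the reflection formula turns them into \<open>L(1, \<chi>) = \<pi> / (2 p) \<Sum>\<^sub>c \<chi>(c) cot (\<pi> c / p)\<close>.
  Orthogonality over the odd characters then gives
  \<open>M(p) = \<pi>\<^sup>2 / (2 p\<^sup>2) \<Sum>\<^sub>c cot (\<pi> q\<^sub>1 c / p) cot (\<pi> q\<^sub>2 c / p)\<close>.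

  By the multiplication formula for the cotangent this sum is \<open>1 / (q\<^sub>1 q\<^sub>2)\<close> times the sum over
  \<open>i < q\<^sub>1\<close>, \<open>j < q\<^sub>2\<close> and \<open>c\<close> of
  \<open>cot (\<pi> c / p + \<pi> i / q\<^sub>1) cot (\<pi> c / p + \<pi> j / q\<^sub>2)\<close>. The term \<open>i = j = 0\<close> contributes
  \<open>\<Sum>\<^sub>c cot\<^sup>2 (\<pi> c / p) = (p - 1) (p - 2) / 3\<close>. In all others the two shifts differ modulo \<open>\<pi>\<close>,
  because \<open>q\<^sub>1\<close> and \<open>q\<^sub>2\<close> are coprime, so
  \<open>cot a cot b = -1 + cot (b - a) (cot a - cot b)\<close> reduces them to sums of single cotangents,
  which are \<open>O(p)\<close> by the multiplication formula again.
\<close>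

section \<open>Finite cotangent sums\<close>

text \<open>A geometric sum whose ratio is an \<open>n\<close>-th root of unity; the ratio is 1
  exactly when \<open>n\<close> divides \<open>k\<close>.\<close>

lemma sum_cis_multiples:
  fixes k :: int and n :: nat
  assumes "n > 0"
  shows "(\<Sum>j<n. cis (2 * pi * of_int k * real j / real n)) = (if int n dvd k then of_nat n else 0)"
proof -
  define z where "z = cis (2 * pi * of_int k / real n)"
  have pow: "cis (2 * pi * of_int k * real j / real n) = z ^ j" for j
    by (simp add: z_def Complex.DeMoivre mult_ac)
  have "z ^ n = cis (2 * pi * of_int k)"
    using assms by (simp add: z_def Complex.DeMoivre)
  then have zn: "z ^ n = 1"
    by simp
  have z1: "z = 1 \<longleftrightarrow> int n dvd k"
  proof
    assume "z = 1"
    then obtain m :: int where "2 * pi * of_int k / real n = of_int m * (2 * pi)"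
      by (auto simp: z_def complex_eq_iff cos_one_2pi_int)
    then have "of_int k = (of_int (m * int n) :: real)"
      using assms by (simp add: field_simps)
    then have "k = m * int n"
      by (simp only: of_int_eq_iff)
    then show "int n dvd k" by simp
  next
    assume "int n dvd k"
    then obtain m where "k = int n * m" ..
    then have "z = cis (2 * pi * of_int m)"
      using assms by (simp add: z_def mult.assoc)
    then show "z = 1"
      using cis_multiple_2pi[of "of_int m"] by simp
  qed
  show ?thesis
  proof (cases "int n dvd k")
    case True
    then show ?thesis using z1 by (simp add: pow)
  next
    case False
    then have "z \<noteq> 1" using z1 by simp
    then show ?thesis using False zn by (simp add: pow geometric_sum)
  qed
qed

text \<open>Pulling \<open>cis x\<close> out of \<open>cis (2 * x) + 1\<close> and
  \<open>cis (2 * x) - 1\<close> leaves the cosine and the sine. Cotangents thus become rational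
  functions of points on the unit circle, which geometric sums can handle.\<close>

lemma cot_eq_cis:
  assumes "sin x \<noteq> 0"
  shows "complex_of_real (cot x) = \<i> * ((cis (2 * x) + 1) / (cis (2 * x) - 1))"
    and "cis (2 * x) \<noteq> 1"
proof -
  have c: "cis (2 * x) = cis x * cis x" by (simp only: cis_mult) simp
  have d: "cis (2 * x) - 1 = cis x * (2 * \<i> * of_real (sin x))"
    unfolding c by (auto simp: complex_eq_iff algebra_simps sin_cos_squared_add3)
  have e: "cis (2 * x) + 1 = cis x * (2 * of_real (cos x))"
    unfolding c by (auto simp: complex_eq_iff algebra_simps sin_cos_squared_add3)
  show "cis (2 * x) \<noteq> 1"
    using d assms by auto
  show "complex_of_real (cot x) = \<i> * ((cis (2 * x) + 1) / (cis (2 * x) - 1))"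
    unfolding d e using assms by (simp add: cot_def field_simps)
qed

lemma sin_add_int_pi_eq_0_iff: "sin (x + pi * of_int k) = 0 \<longleftrightarrow> sin x = 0"
proof -
  have "sin (x + pi * of_int k) = sin x * cos (pi * of_int k)"
    by (simp add: sin_add sin_int_times_real mult.commute)
  moreover have "cos (pi * of_int k) \<noteq> 0"
    by (simp add: cos_int_times_real)
  ultimately show ?thesis by simp
qed

lemma cot_add_int_pi: "cot (x + pi * of_int k) = cot (x :: real)"
proof -
  have "sin (pi * of_int k) = 0" by (simp add: mult.commute)
  moreover from this have "cos (pi * of_int k) \<noteq> 0"
    by (metis cos_zero_iff sin_cos_squared_add zero_neq_one power_zero_numeral add_0)
  ultimately show ?thesis
    by (simp add: cot_def sin_add cos_add)
qed

text \<open>Each summand is a rational function of \<open>w * z j\<close>, where \<open>z j\<close>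
  runs over the \<open>q\<close>-th roots of unity. Since \<open>(w * z j) ^ q\<close> does not
  depend on \<open>j\<close>, expanding in powers of \<open>w * z j\<close> and summing over
  \<open>j\<close> leaves only the constant term.\<close>

lemma cot_multiplication:
  fixes q :: nat
  assumes q: "q > 0" and s: "sin (real q * x) \<noteq> 0"
  shows "(\<Sum>j<q. cot (x + pi * real j / real q)) = real q * cot (real q * x)"
proof -
  define w where "w = cis (2 * x)"
  define z where "z j = cis (2 * pi * real j / real q)" for j
  define W where "W = w ^ q"
  have W: "W = cis (2 * (real q * x))"
    by (simp add: W_def w_def Complex.DeMoivre mult_ac)
  note W1 = cot_eq_cis[OF s, folded W]
  have u: "cis (2 * (x + pi * real j / real q)) = w * z j" for j
    by (simp add: w_def z_def cis_mult algebra_simps)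
  have uq: "(w * z j) ^ q = W" for j
    using q by (simp add: power_mult_distrib W_def z_def Complex.DeMoivre)
  \<comment> \<open>With \<open>u = w * z j\<close>, this is
    \<open>(u + 1) / (u - 1) = 1 + 2 / (u - 1)\<close>, where \<open>1 / (u - 1)\<close> is the
    geometric sum divided by \<open>W - 1\<close>.\<close>
  have each: "complex_of_real (cot (x + pi * real j / real q))
      = \<i> * (1 - 2 / (1 - W) * (\<Sum>k<q. w ^ k * z j ^ k))" for j
  proof -
    have "sin (x + pi * real j / real q) \<noteq> 0"
    proof
      assume "sin (x + pi * real j / real q) = 0"
      then obtain i :: int where i: "x + pi * real j / real q = of_int i * pi"
        by (auto simp: sin_zero_iff_int2)
      have "real q * x = of_int (int q * i - int j) * pi"
        using i q by (simp add: field_simps)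
      with s show False by (metis sin_zero_iff_int2)
    qed
    note c = cot_eq_cis[OF this, unfolded u]
    have "(\<Sum>k<q. (w * z j) ^ k) = (W - 1) / (w * z j - 1)"
      using geometric_sum[OF c(2), of q] by (simp only: uq)
    then have geo: "(\<Sum>k<q. w ^ k * z j ^ k) = (W - 1) / (w * z j - 1)"
      by (simp only: power_mult_distrib)
    show ?thesis unfolding c(1) geo using c(2) W1(2)
      by (simp add: divide_simps) (simp add: algebra_simps)
  qed
  have zk: "(\<Sum>j<q. z j ^ k) = (if k = 0 then of_nat q else 0)" if "k < q" for k
  proof -
    have "(\<Sum>j<q. z j ^ k) = (\<Sum>j<q. cis (2 * pi * of_int (int k) * real j / real q))"
      by (simp add: z_def Complex.DeMoivre mult_ac)
    also have "\<dots> = (if k = 0 then of_nat q else 0)"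
      using that by (subst sum_cis_multiples[OF q]) (auto dest: nat_dvd_not_less)
    finally show ?thesis .
  qed
  have "(\<Sum>j<q. \<Sum>k<q. w ^ k * z j ^ k) = (\<Sum>k<q. w ^ k * (\<Sum>j<q. z j ^ k))"
    by (subst sum.swap) (simp add: sum_distrib_left)
  also have "\<dots> = (\<Sum>k<q. if k = 0 then of_nat q else 0)"
    by (intro sum.cong) (auto simp: zk)
  also have "\<dots> = of_nat q" using q by simp
  finally have dbl: "(\<Sum>j<q. \<Sum>k<q. w ^ k * z j ^ k) = of_nat q" .
  have "complex_of_real (\<Sum>j<q. cot (x + pi * real j / real q))
      = (\<Sum>j<q. \<i> * (1 - 2 / (1 - W) * (\<Sum>k<q. w ^ k * z j ^ k)))"
    by (simp add: each)
  also have "\<dots> = \<i> * (of_nat q - 2 / (1 - W) * of_nat q)"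
    by (simp only: sum_distrib_left[symmetric] sum_subtractf dbl) simp
  also have "\<dots> = of_nat q * (\<i> * ((W + 1) / (W - 1)))"
    using W1(2) by (simp add: divide_simps) (simp add: algebra_simps)
  also have "\<dots> = complex_of_real (real q * cot (real q * x))"
    using W1(1) by simp
  finally show ?thesis
    by (simp only: of_real_eq_iff)
qed

text \<open>This linearises a product of cotangents whose arguments have a fixed difference: summed
  over translates, it needs only sums of single cotangents. It combines the subtraction formulas for
  sine and cosine.\<close>

lemma cot_mult_cot:
  fixes a b :: real
  assumes "sin a \<noteq> 0" "sin b \<noteq> 0" "sin (b - a) \<noteq> 0"
  shows "cot a * cot b = -1 + cot (b - a) * (cot a - cot b)"
proof -
  have "cot a - cot b = sin (b - a) / (sin a * sin b)"
    using assms by (simp add: cot_def field_simps sin_diff)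
  then have "cot (b - a) * (cot a - cot b) = cos (b - a) / (sin a * sin b)"
    using assms by (simp add: cot_def)
  also have "\<dots> = cot a * cot b + 1"
    using assms by (simp add: cot_def field_simps cos_diff)
  finally show ?thesis by simp
qed

section \<open>First and second power sums of cotangents at multiples of
  \<open>pi / n\<close>\<close>

lemma sin_pi_frac_nonzero:
  assumes "c \<in> {1..<n}"
  shows "sin (pi * real c / real n) \<noteq> 0"
proof -
  have "sin (pi * real c / real n) > 0"
    using assms by (intro sin_gt_zero) (auto simp: field_simps)
  then show ?thesis by simp
qed

lemma sum_cot_pi_frac_eq_0: "(\<Sum>c=1..<n. cot (pi * real c / real n)) = 0"
proof -
  have "(\<Sum>c=1..<n. cot (pi * real c / real n)) = (\<Sum>c=1..<n. cot (pi * real (n - c) / real n))"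
    by (rule sum.reindex_bij_witness[of _ "\<lambda>c. n - c" "\<lambda>c. n - c"]) auto
  also have "\<dots> = (\<Sum>c=1..<n. - cot (pi * real c / real n))"
  proof (rule sum.cong)
    fix c assume "c \<in> {1..<n}"
    then have "pi * real (n - c) / real n = - (pi * real c / real n) + pi * of_int 1"
      by (simp add: of_nat_diff field_simps)
    then show "cot (pi * real (n - c) / real n) = - cot (pi * real c / real n)"
      by (simp only: cot_add_int_pi cot_minus)
  qed simp
  finally show ?thesis by (simp add: sum_negf)
qed

text \<open>
  For \<open>\<alpha> = 0\<close> the formula holds thanks to the junk value \<open>cot 0 = 0\<close>.
\<close>
lemma sum_cot_shifted:
  assumes n: "n > 0" and \<alpha>: "\<alpha> = 0 \<or> sin (real n * \<alpha>) \<noteq> 0"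
  shows "(\<Sum>c=1..<n. cot (pi * real c / real n + \<alpha>)) = real n * cot (real n * \<alpha>) - cot \<alpha>"
proof (cases "\<alpha> = 0")
  case True
  then show ?thesis using sum_cot_pi_frac_eq_0[of n] by simp
next
  case False
  have "real n * cot (real n * \<alpha>) = (\<Sum>c<n. cot (\<alpha> + pi * real c / real n))"
    using cot_multiplication[OF n] \<alpha> False by simp
  also have "\<dots> = cot \<alpha> + (\<Sum>c=1..<n. cot (\<alpha> + pi * real c / real n))"
    using n by (simp add: lessThan_atLeast0 sum.atLeast_Suc_lessThan)
  finally show ?thesis by (simp add: add.commute)
qed

text \<open>
  Parseval for the finite Fourier transform of the sawtooth \<open>f\<close>, whose transform
  is \<open>\<i> cot (\<pi> c / n)\<close> up to sign.
\<close>
lemma sum_cot_pi_frac_squared: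
  assumes n: "n > 0"
  shows "(\<Sum>c=1..<n. (cot (pi * real c / real n))\<^sup>2) = (real n - 1) * (real n - 2) / 3"
proof -
  \<comment> \<open>The value 0 at \<open>k = 0\<close>, instead of -1, makes \<open>f\<close> sum
    to 0 and turns the transform into exactly \<open>(z + 1) / (z - 1)\<close>.\<close>
  define f :: "nat \<Rightarrow> real" where "f k = (if k = 0 then 0 else 2 * real k / real n - 1)" for k
  define F where "F c = (\<Sum>k<n. of_real (f k) * cis (2 * pi * real k * real c / real n))" for c
  have split0: "(\<Sum>k<n. g k) = g 0 + (\<Sum>k=1..<n. g k)" for g :: "nat \<Rightarrow> 'a::comm_monoid_add"
    using n by (simp add: lessThan_atLeast0 sum.atLeast_Suc_lessThan)
  have norm_F: "(cmod (F c))\<^sup>2 = (cot (pi * real c / real n))\<^sup>2" if c: "c \<in> {1..<n}" for c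
  proof -
    define z where "z = cis (2 * (pi * real c / real n))"
    have cz: "cis (2 * pi * real k * real c / real n) = z ^ k" for k
      by (simp add: z_def Complex.DeMoivre mult_ac)
    note s = cot_eq_cis[OF sin_pi_frac_nonzero[OF c], folded z_def]
    have zn: "z ^ n = 1"
      using n by (simp add: z_def Complex.DeMoivre) (metis cis_multiple_2pi Ints_of_nat mult.assoc)
    have sum0: "(\<Sum>k<n. z ^ k) = 0"
      using s(2) zn by (simp add: geometric_sum)
    \<comment> \<open>Summation by parts in a form that induction on \<open>m\<close> can prove; at
      \<open>m = n\<close> the last sum vanishes.\<close>
    have gen: "(\<Sum>k<m. of_nat k * z ^ k) * (z - 1) = of_nat m * z ^ m - z * (\<Sum>k<m. z ^ k)" for m
      by (induction m) (auto simp: algebra_simps)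
    have sum1: "(\<Sum>k<n. of_nat k * z ^ k) = of_nat n / (z - 1)"
      using gen[of n] s(2) zn sum0 by (simp add: field_simps)
    \<comment> \<open>The indicator of \<open>k = 0\<close> corrects the linear expression to
      \<open>f 0 = 0\<close>.\<close>
    have "F c = (\<Sum>k<n. 2 / of_nat n * (of_nat k * z ^ k) - z ^ k + (if k = 0 then 1 else 0))"
      unfolding F_def cz by (intro sum.cong) (auto simp: f_def algebra_simps)
    also have "\<dots> = 2 / of_nat n * (of_nat n / (z - 1)) - 0 + 1"
      unfolding sum.distrib sum_subtractf sum_distrib_left[symmetric] sum0 sum1
      using n by simp
    also have "\<dots> = (z + 1) / (z - 1)"
      using n s(2) by (simp add: field_simps)
    finally have "complex_of_real (cot (pi * real c / real n)) = \<i> * F c"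
      using s(1) by simp
    then have "cmod (F c) = \<bar>cot (pi * real c / real n)\<bar>"
      by (metis norm_of_real norm_mult norm_ii mult_1)
    then show ?thesis by simp
  qed
  have gauss1: "(\<Sum>k=1..<m. real k) = real m * (real m - 1) / 2" if "m > 0" for m :: nat
    using that by (induction m rule: nat_induct_non_zero) (auto simp: field_simps)
  have gauss2: "(\<Sum>k=1..<m. (real k)\<^sup>2) = real m * (real m - 1) * (2 * real m - 1) / 6"
    if "m > 0" for m :: nat
    using that by (induction m rule: nat_induct_non_zero) (auto simp: field_simps power2_eq_square)
  have "(\<Sum>k<n. f k) = (\<Sum>k=1..<n. 2 / real n * real k - 1)"
    by (subst split0) (auto simp: f_def intro!: sum.cong)
  also have "\<dots> = 2 / real n * (real n * (real n - 1) / 2) - (real n - 1)"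
    unfolding sum_subtractf sum_distrib_left[symmetric] gauss1[OF n] using n by (simp add: of_nat_diff)
  also have "\<dots> = 0" using n by simp
  finally have "F 0 = 0"
    by (simp add: F_def flip: of_real_sum)
  have "(\<Sum>k<n. (f k)\<^sup>2)
      = (\<Sum>k=1..<n. 4 / (real n)\<^sup>2 * (real k)\<^sup>2 - 4 / real n * real k + 1)"
    by (subst split0) (auto simp: f_def power2_eq_square field_simps intro!: sum.cong)
  also have "\<dots> = 4 / (real n)\<^sup>2 * (real n * (real n - 1) * (2 * real n - 1) / 6)
      - 4 / real n * (real n * (real n - 1) / 2) + (real n - 1)"
    unfolding sum.distrib sum_subtractf sum_distrib_left[symmetric] gauss1[OF n] gauss2[OF n]
    using n by (simp add: of_nat_diff)
  also have "\<dots> = (real n - 1) * (real n - 2) / (3 * real n)"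
    using n by (simp add: divide_simps power2_eq_square) (simp add: algebra_simps)
  finally have f_sq: "(\<Sum>k<n. (f k)\<^sup>2) = (real n - 1) * (real n - 2) / (3 * real n)" .
  have "complex_of_real (\<Sum>c<n. (cmod (F c))\<^sup>2) = (\<Sum>c<n. F c * cnj (F c))"
    by (simp only: of_real_sum complex_norm_square)
  also have "\<dots> = (\<Sum>c<n. \<Sum>k<n. \<Sum>l<n. of_real (f k * f l) *
      cis (2 * pi * of_int (int k - int l) * real c / real n))"
    unfolding F_def cnj_sum sum_product
    by (intro sum.cong refl)
       (simp add: cis_cnj cis_mult algebra_simps diff_divide_distrib add_divide_distrib)
  \<comment> \<open>With the frequency \<open>c\<close> summed innermost, orthogonality leaves only
    the diagonal \<open>l = k\<close>.\<close>
  also have "\<dots> = (\<Sum>k<n. \<Sum>l<n. of_real (f k * f l) *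
      (\<Sum>c<n. cis (2 * pi * of_int (int k - int l) * real c / real n)))"
    unfolding sum_distrib_left by (rule trans[OF sum.swap], rule sum.cong[OF refl], rule sum.swap)
  also have "\<dots> = (\<Sum>k<n. \<Sum>l<n. of_real (f k * f l) * (if l = k then of_nat n else 0))"
  proof (intro sum.cong refl arg_cong2[where f = "(*)"])
    fix k l assume "k \<in> {..<n}" "l \<in> {..<n}"
    then have "int n dvd int k - int l \<longleftrightarrow> l = k"
      by (auto simp: mod_eq_dvd_iff[symmetric])
    then show "(\<Sum>c<n. cis (2 * pi * of_int (int k - int l) * real c / real n))
        = (if l = k then of_nat n else 0)"
      using sum_cis_multiples[OF n, of "int k - int l"] by simp
  qed
  also have "\<dots> = of_real (real n * (\<Sum>k<n. (f k)\<^sup>2))"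
    by (simp add: sum_distrib_left power2_eq_square mult_ac if_distrib cong: if_cong)
  finally have parseval: "(\<Sum>c<n. (cmod (F c))\<^sup>2) = real n * (\<Sum>k<n. (f k)\<^sup>2)"
    by (simp only: of_real_eq_iff)
  \<comment> \<open>The frequency 0 may be added because \<open>F 0 = 0\<close>.\<close>
  have "(\<Sum>c=1..<n. (cot (pi * real c / real n))\<^sup>2) = (\<Sum>c<n. (cmod (F c))\<^sup>2)"
    by (subst split0) (simp add: \<open>F 0 = 0\<close> norm_F)
  also have "\<dots> = (real n - 1) * (real n - 2) / 3"
    unfolding parseval f_sq using n by simp
  finally show ?thesis .
qed

section \<open>Asymptotics of the twisted cotangent sum\<close>

text \<open>By \<open>sum_cot_shifted\<close> the sum is governed by the cotangents of
  \<open>p * \<alpha>\<close> and \<open>\<alpha>\<close>. Both are, modulo \<open>pi\<close>,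
  multiples of \<open>pi / q\<close>, so they take finitely many values that do not depend on
  \<open>p\<close>.\<close>

lemma sum_cot_shifted_bound:
  assumes p: "p > 0" and pq: "coprime p q" and i: "i < q"
  shows "\<bar>\<Sum>c=1..<p. cot (pi * real c / real p + pi * real i / real q)\<bar>
    \<le> 2 * real p * (\<Sum>r<q. \<bar>cot (pi * real r / real q)\<bar>)"
proof -
  define \<alpha> where "\<alpha> = pi * real i / real q"
  define K where "K = (\<Sum>r<q. \<bar>cot (pi * real r / real q)\<bar>)"
  have q: "q > 0" using i by simp
  have K: "\<bar>cot (pi * real r / real q)\<bar> \<le> K" if "r < q" for r
    unfolding K_def using that by (intro member_le_sum) auto
  have p\<alpha>: "real p * \<alpha> = pi * real (p * i mod q) / real q + pi * of_int (int (p * i div q))"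
  proof -
    have "real (p * i) = real q * real (p * i div q) + real (p * i mod q)"
      by (metis mult_div_mod_eq of_nat_add of_nat_mult)
    then show ?thesis using q by (simp add: \<alpha>_def field_simps)
  qed
  \<comment> \<open>For \<open>i\<close> nonzero, coprimality keeps \<open>p * i\<close> off the
    multiples of \<open>q\<close>, so there is no pole.\<close>
  have "\<alpha> = 0 \<or> sin (real p * \<alpha>) \<noteq> 0"
  proof (cases "i = 0")
    case False
    then have "\<not> q dvd p * i"
      using i pq by (metis coprime_commute coprime_dvd_mult_right_iff dvd_imp_le not_le gr0I)
    then have "p * i mod q \<in> {1..<q}"
      using q by (auto simp: dvd_eq_mod_eq_0)
    then show ?thesis
      unfolding p\<alpha> sin_add_int_pi_eq_0_iff using sin_pi_frac_nonzero by blast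
  qed (simp add: \<alpha>_def)
  then have "(\<Sum>c=1..<p. cot (pi * real c / real p + \<alpha>)) = real p * cot (real p * \<alpha>) - cot \<alpha>"
    by (rule sum_cot_shifted[OF p])
  moreover have "\<bar>cot (real p * \<alpha>)\<bar> \<le> K"
    unfolding p\<alpha> cot_add_int_pi using q by (intro K) simp
  moreover have "\<bar>cot \<alpha>\<bar> \<le> K"
    unfolding \<alpha>_def using i by (rule K)
  moreover have "K \<le> real p * K"
    using p K[OF i] mult_right_mono[of 1 "real p" K] by simp
  moreover have "\<bar>real p * cot (real p * \<alpha>)\<bar> \<le> real p * K" if "\<bar>cot (real p * \<alpha>)\<bar> \<le> K"
    using that by (simp add: abs_mult mult_left_mono)
  ultimately have "\<bar>\<Sum>c=1..<p. cot (pi * real c / real p + \<alpha>)\<bar> \<le> 2 * (real p * K)"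
    by linarith
  then show ?thesis by (simp add: K_def \<alpha>_def)
qed

text \<open>If the two shifts agreed modulo \<open>pi\<close>, clearing denominators would give
  \<open>q1 dvd i\<close> and \<open>q2 dvd j\<close> by coprimality, hence
  \<open>i = j = 0\<close>.\<close>

lemma sin_frac_diff_nonzero:
  assumes q: "coprime q1 q2" and ij: "i < q1" "j < q2" "i \<noteq> 0 \<or> j \<noteq> 0"
  shows "sin (pi * real j / real q2 - pi * real i / real q1) \<noteq> 0"
proof
  assume "sin (pi * real j / real q2 - pi * real i / real q1) = 0"
  then obtain k :: int where k: "pi * real j / real q2 - pi * real i / real q1 = of_int k * pi"
    by (auto simp: sin_zero_iff_int2)
  have "pi * (real j / real q2 - real i / real q1) = pi * of_int k"
    using k by (simp add: algebra_simps)
  then have "real j / real q2 - real i / real q1 = of_int k"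
    by (simp only: mult_cancel_left) simp
  then have "real j * real q1 - real i * real q2 = of_int k * real q1 * real q2"
    using ij by (simp add: field_simps)
  then have "real_of_int (int j * int q1 - int i * int q2) = of_int (k * int q1 * int q2)"
    by simp
  then have eq: "int j * int q1 - int i * int q2 = k * int q1 * int q2"
    by (simp only: of_int_eq_iff)
  have "int i * int q2 = int q1 * (int j - k * int q2)"
    using eq by (simp add: algebra_simps)
  then have "int q1 dvd int i * int q2" by simp
  then have "q1 dvd i"
    using q by (simp add: coprime_dvd_mult_left_iff)
  then have i0: "i = 0" using ij by (metis dvd_imp_le not_le gr0I)
  have "int j * int q1 = int q2 * (int i + k * int q1)"
    using eq by (simp add: algebra_simps)
  then have "int q2 dvd int j * int q1" by simp
  then have "q2 dvd j"
    using q by (simp add: coprime_dvd_mult_left_iff coprime_commute)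
  then have "j = 0" using ij by (metis dvd_imp_le not_le gr0I)
  with i0 ij show False by simp
qed

text \<open>Excludes poles, as \<open>cot_multiplication\<close> requires at the points
  \<open>pi * c / p\<close>.\<close>

lemma sin_pi_multiple_frac_nonzero:
  assumes "coprime p q" and c: "c \<in> {1..<p}"
  shows "sin (real q * (pi * real c / real p)) \<noteq> 0"
proof -
  have p: "p > 0" using c by simp
  have "\<not> p dvd q * c"
    using assms by (auto simp: coprime_dvd_mult_right_iff dest: dvd_imp_le)
  then have r: "q * c mod p \<in> {1..<p}"
    using p by (auto simp: dvd_eq_mod_eq_0)
  have "real (q * c) = real p * real (q * c div p) + real (q * c mod p)"
    by (metis mult_div_mod_eq of_nat_add of_nat_mult)
  then have "real q * (pi * real c / real p)
      = pi * real (q * c mod p) / real p + pi * of_int (int (q * c div p))"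
    using p by (simp add: field_simps)
  then show ?thesis
    using sin_pi_frac_nonzero[OF r] by (simp only: sin_add_int_pi_eq_0_iff) simp
qed

text \<open>The \<open>obtains\<close> form fixes \<open>C\<close> before \<open>p\<close>, which
  makes the error uniform in \<open>p\<close>. Among the \<open>q1 * q2\<close> sums
  \<open>T i j\<close> produced by the multiplication formula, only \<open>T 0 0\<close> has order
  \<open>p\<close> squared.\<close>

lemma sum_cot_mult_cot_asymp:
  fixes q1 q2 :: nat
  assumes q: "q1 > 0" "q2 > 0" "coprime q1 q2"
  obtains C where "\<And>p. p > 0 \<Longrightarrow> coprime p q1 \<Longrightarrow> coprime p q2 \<Longrightarrow>
    \<bar>(\<Sum>c=1..<p. cot (real q1 * (pi * real c / real p)) * cot (real q2 * (pi * real c / real p)))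
      - (real p)\<^sup>2 / (3 * real q1 * real q2)\<bar> \<le> C * real p"
proof
  define K where "K m = (\<Sum>r<m. \<bar>cot (pi * real r / real m)\<bar>)" for m :: nat
  \<comment> \<open>The 1 pays for the constant -1 in \<open>cot_mult_cot\<close>, the rest for its
    two single cotangent sums. Neither \<open>K\<close> nor \<open>B\<close> involves
    \<open>p\<close>.\<close>
  define B where "B i j = 1 + \<bar>cot (pi * real j / real q2 - pi * real i / real q1)\<bar> *
    (2 * (K q1 + K q2))" for i j :: nat
  fix p :: nat assume p: "p > 0" and cop: "coprime p q1" "coprime p q2"
  define x where "x c = pi * real c / real p" for c :: nat
  define T where "T i j = (\<Sum>c=1..<p. cot (x c + pi * real i / real q1) * cot (x c + pi * real j / real q2))"
    for i j :: nat
  define M where "M i j = (if i = 0 \<and> j = 0 then (real p)\<^sup>2 / 3 else 0)" for i j :: nat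
  have K0: "K m \<ge> 0" for m by (simp add: K_def sum_nonneg)
  have T: "\<bar>T i j - M i j\<bar> \<le> B i j * real p" if ij: "i < q1" "j < q2" for i j
  proof (cases "i = 0 \<and> j = 0")
    case True
    have "T i j = (real p - 1) * (real p - 2) / 3"
      using True sum_cot_pi_frac_squared[OF p] by (simp add: T_def x_def power2_eq_square)
    then have "T i j - M i j = 2 / 3 - real p"
      using True by (simp add: M_def field_simps power2_eq_square)
    then have "\<bar>T i j - M i j\<bar> \<le> 1 * real p" using p by linarith
    also have "\<dots> \<le> B i j * real p"
      using K0[of q1] K0[of q2] by (intro mult_right_mono) (simp_all add: B_def)
    finally show ?thesis .
  next
    case False
    define \<alpha> where "\<alpha> = pi * real i / real q1"
    define \<beta> where "\<beta> = pi * real j / real q2"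
    have s: "sin (\<beta> - \<alpha>) \<noteq> 0"
      unfolding \<alpha>_def \<beta>_def using False ij q by (intro sin_frac_diff_nonzero) auto
    \<comment> \<open>A zero at a shifted point would, after multiplication by \<open>m\<close>, be
      a zero of the sine at \<open>m * x c\<close>.\<close>
    have nz: "sin (x c + pi * real k / real m) \<noteq> 0"
      if c: "c \<in> {1..<p}" and m: "coprime p m" "m > 0" for c k m
    proof
      assume "sin (x c + pi * real k / real m) = 0"
      then obtain l :: int where l: "x c + pi * real k / real m = of_int l * pi"
        by (auto simp: sin_zero_iff_int2)
      have "real m * x c = of_int (int m * l - int k) * pi"
        using l m by (simp add: field_simps)
      then have "sin (real m * x c) = 0" by (metis sin_zero_iff_int2)
      then show False using sin_pi_multiple_frac_nonzero[OF m(1) c] by (simp add: x_def)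
    qed
    have "T i j = (\<Sum>c=1..<p. -1 + cot (\<beta> - \<alpha>) * (cot (x c + \<alpha>) - cot (x c + \<beta>)))"
      unfolding T_def
    proof (intro sum.cong refl)
      fix c assume c: "c \<in> {1..<p}"
      show "cot (x c + pi * real i / real q1) * cot (x c + pi * real j / real q2)
        = -1 + cot (\<beta> - \<alpha>) * (cot (x c + \<alpha>) - cot (x c + \<beta>))"
        using cot_mult_cot[of "x c + \<alpha>" "x c + \<beta>"] nz[OF c cop(1) q(1), of i]
          nz[OF c cop(2) q(2), of j] s by (simp add: \<alpha>_def \<beta>_def)
    qed
    also have "\<dots> = - (real p - 1) + cot (\<beta> - \<alpha>) *
        ((\<Sum>c=1..<p. cot (x c + \<alpha>)) - (\<Sum>c=1..<p. cot (x c + \<beta>)))"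
      using p by (simp add: sum.distrib sum_subtractf of_nat_diff flip: sum_distrib_left)
    finally have "\<bar>T i j\<bar> \<le> real p + \<bar>cot (\<beta> - \<alpha>)\<bar> *
        (\<bar>\<Sum>c=1..<p. cot (x c + \<alpha>)\<bar> + \<bar>\<Sum>c=1..<p. cot (x c + \<beta>)\<bar>)"
      using p mult_left_mono[OF abs_triangle_ineq4, of "\<bar>cot (\<beta> - \<alpha>)\<bar>"
        "\<Sum>c=1..<p. cot (x c + \<alpha>)" "\<Sum>c=1..<p. cot (x c + \<beta>)"]
      by (simp add: abs_mult[symmetric] flip: abs_mult)
    also have "\<dots> \<le> real p + \<bar>cot (\<beta> - \<alpha>)\<bar> * (2 * real p * K q1 + 2 * real p * K q2)"
      unfolding x_def \<alpha>_def \<beta>_def K_def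
      by (intro add_left_mono mult_left_mono add_mono sum_cot_shifted_bound p cop ij) simp
    also have "\<dots> = B i j * real p"
      by (simp add: B_def \<alpha>_def \<beta>_def algebra_simps)
    finally show ?thesis using False by (auto simp: M_def)
  qed
  have cot_q: "cot (real m * x c) = (\<Sum>i<m. cot (x c + pi * real i / real m)) / real m"
    if "c \<in> {1..<p}" "coprime p m" "m > 0" for c m
    using cot_multiplication[of m "x c"] sin_pi_multiple_frac_nonzero[OF that(2,1)] that(3)
    by (simp add: x_def)
  have "(\<Sum>c=1..<p. cot (real q1 * x c) * cot (real q2 * x c))
      = (\<Sum>c=1..<p. \<Sum>i<q1. \<Sum>j<q2. cot (x c + pi * real i / real q1) *
           cot (x c + pi * real j / real q2)) / (real q1 * real q2)"
    unfolding sum_divide_distrib[of _ "{1..<p}"]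
    by (intro sum.cong refl) (simp add: cot_q cop q sum_product)
  also have "(\<Sum>c=1..<p. \<Sum>i<q1. \<Sum>j<q2. cot (x c + pi * real i / real q1) *
           cot (x c + pi * real j / real q2)) = (\<Sum>i<q1. \<Sum>j<q2. T i j)"
    unfolding T_def by (rule trans[OF sum.swap], rule sum.cong[OF refl], rule sum.swap)
  finally have S: "(\<Sum>c=1..<p. cot (real q1 * x c) * cot (real q2 * x c))
      = (\<Sum>i<q1. \<Sum>j<q2. T i j) / (real q1 * real q2)" .
  have "(\<Sum>i<q1. \<Sum>j<q2. M i j) = (\<Sum>i<q1. if i = 0 then (real p)\<^sup>2 / 3 else 0)"
    using q by (intro sum.cong refl) (auto simp: M_def)
  also have "\<dots> = (real p)\<^sup>2 / 3" using q by simp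
  finally have M: "(\<Sum>i<q1. \<Sum>j<q2. M i j) = (real p)\<^sup>2 / 3" .
  have "(\<Sum>c=1..<p. cot (real q1 * x c) * cot (real q2 * x c)) - (real p)\<^sup>2 / (3 * real q1 * real q2)
      = (\<Sum>i<q1. \<Sum>j<q2. T i j - M i j) / (real q1 * real q2)"
    unfolding S sum_subtractf M by (simp add: diff_divide_distrib)
  then have "\<bar>(\<Sum>c=1..<p. cot (real q1 * x c) * cot (real q2 * x c))
      - (real p)\<^sup>2 / (3 * real q1 * real q2)\<bar>
      = \<bar>\<Sum>i<q1. \<Sum>j<q2. T i j - M i j\<bar> / (real q1 * real q2)"
    by simp
  also have "\<dots> \<le> (\<Sum>i<q1. \<Sum>j<q2. B i j * real p) / (real q1 * real q2)"
    by (intro divide_right_mono order_trans[OF sum_abs] sum_mono T) auto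
  \<comment> \<open>The witness for \<open>C\<close> is read off here: the sum of all
    \<open>B i j\<close> divided by \<open>q1 * q2\<close>.\<close>
  finally show "\<bar>(\<Sum>c=1..<p. cot (real q1 * (pi * real c / real p)) * cot (real q2 * (pi * real c / real p)))
      - (real p)\<^sup>2 / (3 * real q1 * real q2)\<bar>
      \<le> (\<Sum>i<q1. \<Sum>j<q2. B i j) / (real q1 * real q2) * real p"
    by (simp add: x_def flip: sum_distrib_right)
qed

section \<open>Values at 1 of odd periodic series\<close>

text \<open>Both sides come from differentiating \<open>rGamma w * rGamma (1 - w)\<close> at
  \<open>z\<close>, once by the product rule and once as \<open>sin (pi * w) / pi\<close>.\<close>

lemma Digamma_reflection:
  fixes z :: complex
  assumes "z \<notin> \<int>"
  shows "Digamma (1 - z) - Digamma z = of_real pi * cot (of_real pi * z)"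
proof -
  have z1: "1 - z \<notin> \<int>"
    using assms by (metis Ints_1 Ints_diff add_diff_cancel_left' diff_add_cancel minus_diff_eq)
  have nonpos: "z \<notin> \<int>\<^sub>\<le>\<^sub>0" "1 - z \<notin> \<int>\<^sub>\<le>\<^sub>0"
    using assms z1 nonpos_Ints_Int by blast+
  have s: "sin (of_real pi * z) \<noteq> 0"
    using assms by (auto simp: sin_eq_0)
  have "((\<lambda>w. rGamma w * rGamma (1 - w)) has_field_derivative
      rGamma z * rGamma (1 - z) * (Digamma (1 - z) - Digamma z)) (at z)"
    using nonpos by (auto intro!: derivative_eq_intros simp: algebra_simps)
  moreover have "((\<lambda>w. rGamma w * rGamma (1 - w)) has_field_derivative
      cos (of_real pi * z)) (at z)"
    unfolding rGamma_reflection_complex by (auto intro!: derivative_eq_intros)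
  ultimately have "sin (of_real pi * z) / of_real pi * (Digamma (1 - z) - Digamma z)
      = cos (of_real pi * z)"
    by (metis DERIV_unique rGamma_reflection_complex)
  then show ?thesis using s by (simp add: cot_def field_simps)
qed

section \<open>Summation of conditionally convergent series in blocks\<close>

lemma sum_lessThan_add:
  fixes f :: "nat \<Rightarrow> 'a::comm_monoid_add"
  shows "(\<Sum>n<m + r. f n) = (\<Sum>n<m. f n) + (\<Sum>i<r. f (m + i))"
  by (induction r) (simp_all add: add.assoc)

lemma sum_blocks:
  fixes f :: "nat \<Rightarrow> 'a::comm_monoid_add"
  shows "(\<Sum>n<N * p. f n) = (\<Sum>i<p. \<Sum>k<N. f (k * p + i))"
  by (induction N) (simp_all add: sum_lessThan_add sum.distrib add.commute[of p])

text \<open>A general partial sum exceeds one over complete blocks by fewer than \<open>p\<close>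
  terms, all taken from the tail of a null sequence.\<close>

lemma sums_of_block_LIMSEQ:
  fixes g :: "nat \<Rightarrow> 'a::real_normed_vector"
  assumes p: "p > 0" and g: "g \<longlonglongrightarrow> 0"
    and lim: "(\<lambda>N. \<Sum>n<N * p. g n) \<longlonglongrightarrow> l"
  shows "g sums l"
proof -
  have div: "filterlim (\<lambda>n. n div p) at_top at_top"
    unfolding filterlim_at_top eventually_at_top_linorder
    using p by (metis div_le_mono nonzero_mult_div_cancel_right less_not_refl)
  have mult: "filterlim (\<lambda>n. n div p * p + i) at_top at_top" for i
    by (rule filterlim_at_top_mono[OF div]) (use p in \<open>auto intro!: always_eventually trans_le_add1\<close>)
  have "(\<Sum>k<n. g k) = (\<Sum>k<n div p * p. g k) + (\<Sum>i<n mod p. g (n div p * p + i))" for n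
    using sum_lessThan_add[of g "n div p * p" "n mod p"] by simp
  then have split: "(\<lambda>n. \<Sum>k<n. g k)
      = (\<lambda>n. (\<Sum>k<n div p * p. g k) + (\<Sum>i<n mod p. g (n div p * p + i)))" by blast
  \<comment> \<open>The norms over a full block of fixed length \<open>p\<close> dominate the
    incomplete block.\<close>
  have "(\<lambda>n. \<Sum>i<p. norm (g (n div p * p + i))) \<longlonglongrightarrow> (\<Sum>i<p. 0)"
    by (intro tendsto_sum tendsto_norm_zero filterlim_compose[OF g mult])
  then have "(\<lambda>n. \<Sum>i<n mod p. g (n div p * p + i)) \<longlonglongrightarrow> 0"
  proof (rule Lim_null_comparison[rotated, OF tendsto_eq_rhs])
    show "\<forall>\<^sub>F n in sequentially. norm (\<Sum>i<n mod p. g (n div p * p + i))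
        \<le> (\<Sum>i<p. norm (g (n div p * p + i)))"
      using p by (intro always_eventually allI order_trans[OF norm_sum] sum_mono2) (auto simp: less_trans)
  qed simp
  moreover have "(\<lambda>n. \<Sum>k<n div p * p. g k) \<longlonglongrightarrow> l"
    by (rule filterlim_compose[OF lim div])
  ultimately have "(\<lambda>n. \<Sum>k<n. g k) \<longlonglongrightarrow> l + 0"
    unfolding split by (intro tendsto_add)
  then show ?thesis by (simp add: sums_def)
qed

text \<open>Sorted by residue, a sum over \<open>N\<close> blocks consists of sums of
  \<open>inverse (z i + k)\<close> over \<open>k < N\<close>, each growing like \<open>ln N\<close>.
  The vanishing mean of \<open>f\<close> cancels the logarithms, and \<open>Digamma\<close> is the
  limit of what remains.\<close>

lemma sums_periodic_div:
  fixes f :: "nat \<Rightarrow> complex"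
  assumes p: "p > 0" and per: "\<And>n. f (n + p) = f n" and zero: "(\<Sum>i<p. f (Suc i)) = 0"
  shows "(\<lambda>n. f (Suc n) / of_nat (Suc n)) sums
     (- (\<Sum>i<p. f (Suc i) * Digamma (of_nat (Suc i) / of_nat p)) / of_nat p)"
proof (rule sums_of_block_LIMSEQ[OF p])
  have per': "f (k * p + n) = f n" for k n
  proof (induction k)
    case (Suc k)
    have "Suc k * p + n = k * p + n + p" by simp
    then show ?case using Suc by (simp only: per)
  qed simp
  define K where "K = (\<Sum>i<p. norm (f i))"
  have K: "norm (f n) \<le> K" for n
  proof -
    have "f n = f (n mod p)"
      using per'[of "n div p" "n mod p"] by simp
    then show ?thesis
      using p by (auto simp: K_def intro!: member_le_sum)
  qed
  have "(\<lambda>n. K * inverse (real (Suc n))) \<longlonglongrightarrow> 0"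
    using tendsto_mult_right_zero[OF LIMSEQ_inverse_real_of_nat] .
  then show "(\<lambda>n. f (Suc n) / of_nat (Suc n)) \<longlonglongrightarrow> 0"
  proof (rule Lim_null_comparison[rotated], intro always_eventually allI)
    fix n
    have "norm (f (Suc n) / of_nat (Suc n)) = norm (f (Suc n)) * inverse (real (Suc n))"
      by (simp only: norm_divide norm_of_nat) (simp only: divide_inverse)
    also have "\<dots> \<le> K * inverse (real (Suc n))"
      by (intro mult_right_mono K) simp
    finally show "norm (f (Suc n) / of_nat (Suc n)) \<le> K * inverse (real (Suc n))" .
  qed
  define z where "z i = (of_nat (Suc i) / of_nat p :: complex)" for i
  have z0: "z i \<noteq> 0" for i
    using p unfolding z_def by (metis divide_eq_0_iff of_nat_eq_0_iff nat.simps(3) less_not_refl)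
  \<comment> \<open>The term \<open>ln N\<close> can be inserted because the values of
    \<open>f\<close> over a period sum to 0.\<close>
  have "(\<Sum>n<N * p. f (Suc n) / of_nat (Suc n)) = - (\<Sum>i<p. f (Suc i) *
     (of_real (ln (real N)) - (\<Sum>k<N. inverse (z i + of_nat k)))) / of_nat p" for N
  proof -
    have "(\<Sum>n<N * p. f (Suc n) / of_nat (Suc n))
        = (\<Sum>i<p. \<Sum>k<N. f (Suc i) * (inverse (z i + of_nat k) / of_nat p))"
      unfolding sum_blocks
    proof (intro sum.cong refl)
      fix i k
      have "f (Suc (k * p + i)) = f (Suc i)"
        using per'[of k "Suc i"] by simp
      moreover have "of_nat (Suc (k * p + i)) = (z i + of_nat k) * of_nat p"
        using p by (simp add: z_def field_simps)
      ultimately show "f (Suc (k * p + i)) / of_nat (Suc (k * p + i))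
          = f (Suc i) * (inverse (z i + of_nat k) / of_nat p)"
        by (simp only: divide_inverse inverse_mult_distrib)
    qed
    also have "\<dots> = (\<Sum>i<p. f (Suc i) * (\<Sum>k<N. inverse (z i + of_nat k))) / of_nat p"
      by (simp add: sum_distrib_left sum_divide_distrib)
    also have "\<dots> = - (\<Sum>i<p. f (Suc i) *
        (of_real (ln (real N)) - (\<Sum>k<N. inverse (z i + of_nat k)))) / of_nat p"
      by (simp add: right_diff_distrib sum_subtractf zero flip: sum_distrib_right)
    finally show ?thesis .
  qed
  moreover have "(\<lambda>N. - (\<Sum>i<p. f (Suc i) *
     (of_real (ln (real N)) - (\<Sum>k<N. inverse (z i + of_nat k)))) / of_nat p)
     \<longlonglongrightarrow> - (\<Sum>i<p. f (Suc i) * Digamma (z i)) / of_nat p"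
    by (intro tendsto_intros Digamma_LIMSEQ z0) (use p in auto)
  ultimately show "(\<lambda>N. \<Sum>n<N * p. f (Suc n) / of_nat (Suc n))
     \<longlonglongrightarrow> - (\<Sum>i<p. f (Suc i) * Digamma (of_nat (Suc i) / of_nat p)) / of_nat p"
    by (simp add: z_def)
qed

text \<open>Oddness pairs \<open>c\<close> with \<open>p - c\<close>, so the digamma values enter
  only through differences to which the reflection formula applies.\<close>

lemma suminf_odd_periodic_div:
  fixes f :: "int \<Rightarrow> complex"
  assumes p: "p > 0" and per: "\<And>a. f (a + int p) = f a" and odd: "\<And>a. f (- a) = - f a"
  shows "(\<Sum>n. f (int (Suc n)) / of_nat (Suc n))
    = of_real (pi / (2 * real p)) * (\<Sum>c=1..<p. f (int c) * of_real (cot (pi * real c / real p)))"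
proof -
  have f0: "f 0 = 0" using odd[of 0] by simp
  have fp: "f (int p) = 0" using per[of 0] f0 by simp
  have reflect: "f (int (p - c)) = - f (int c)" if "c \<in> {1..<p}" for c
  proof -
    have "int (p - c) = - int c + int p" using that by (simp add: of_nat_diff)
    then show ?thesis by (simp only: per odd)
  qed
  \<comment> \<open>The series starts at index 1, so a period ends at \<open>p\<close>, where
    \<open>f\<close> vanishes.\<close>
  have shift: "(\<Sum>i<p. f (int (Suc i)) * g (Suc i)) = (\<Sum>c=1..<p. f (int c) * g c)" for g
  proof -
    have "(\<Sum>i<p. f (int (Suc i)) * g (Suc i)) = (\<Sum>c=1..<Suc p. f (int c) * g c)"
      unfolding lessThan_atLeast0 One_nat_def
      by (rule sum.shift_bounds_Suc_ivl[symmetric])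
    then show ?thesis using p fp by simp
  qed
  have swap: "(\<Sum>c=1..<p. f (int c) * g c) = - (\<Sum>c=1..<p. f (int c) * g (p - c))" for g
  proof -
    have "(\<Sum>c=1..<p. f (int c) * g c) = (\<Sum>c=1..<p. f (int (p - c)) * g (p - c))"
      by (rule sum.reindex_bij_witness[of _ "\<lambda>c. p - c" "\<lambda>c. p - c"]) auto
    also have "\<dots> = (\<Sum>c=1..<p. - (f (int c) * g (p - c)))"
      by (intro sum.cong refl) (simp only: reflect mult_minus_left)
    finally show ?thesis by (simp add: sum_negf)
  qed
  define D where "D c = Digamma (of_nat c / of_nat p :: complex)" for c
  have "(\<Sum>i<p. f (int (Suc i))) = 0"
    using shift[of "\<lambda>_. 1"] swap[of "\<lambda>_. 1"] by simp
  then have "(\<lambda>n. f (int (Suc n)) / of_nat (Suc n)) sums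
      (- (\<Sum>i<p. f (int (Suc i)) * D (Suc i)) / of_nat p)"
    unfolding D_def by (intro sums_periodic_div[of p "\<lambda>n. f (int n)"] p) (simp_all add: per)
  then have "(\<Sum>n. f (int (Suc n)) / of_nat (Suc n)) = - (\<Sum>c=1..<p. f (int c) * D c) / of_nat p"
    unfolding shift by (rule sums_unique[symmetric])
  \<comment> \<open>Averages the sum with its image under \<open>c\<close> to \<open>p - c\<close>;
    this is the source of the 2 in \<open>pi / (2 * p)\<close>.\<close>
  also have "- (\<Sum>c=1..<p. f (int c) * D c) = (\<Sum>c=1..<p. f (int c) * (D (p - c) - D c)) / 2"
    using swap[of D] by (simp add: right_diff_distrib sum_subtractf)
  also have "(\<Sum>c=1..<p. f (int c) * (D (p - c) - D c))
      = (\<Sum>c=1..<p. f (int c) * (of_real pi * of_real (cot (pi * real c / real p))))"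
  proof (intro sum.cong refl arg_cong2[where f = "(*)"])
    fix c assume c: "c \<in> {1..<p}"
    have "complex_of_real (real c / real p) \<notin> \<int>"
    proof
      assume "complex_of_real (real c / real p) \<in> \<int>"
      then obtain k where "complex_of_real (real c / real p) = of_int k" by (rule Ints_cases)
      then have "real c / real p = of_int k" by (metis of_real_eq_iff of_real_of_int_eq)
      moreover have "0 < real c / real p" "real c / real p < 1" using c by auto
      ultimately show False by simp
    qed
    note Digamma_reflection[OF this]
    moreover have "1 - complex_of_real (real c / real p) = of_nat (p - c) / of_nat p"
      using c by (simp add: of_nat_diff field_simps)
    moreover have "cot (of_real pi * complex_of_real (real c / real p))
        = of_real (cot (pi * real c / real p))"
      by (simp add: cot_of_real)
    ultimately show "D (p - c) - D c = of_real pi * of_real (cot (pi * real c / real p))"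
      by (simp add: D_def)
  qed
  finally show ?thesis
    by (simp add: sum_distrib_left sum_divide_distrib mult_ac)
qed

section \<open>Odd characters modulo a prime\<close>

lemma dirichlet_character_cong:
  assumes "dirichlet_character m \<psi>" and "[a = b] (mod int m)"
  shows "\<psi> a = \<psi> b"
proof -
  have per: "\<psi> (a + int m) = \<psi> a" for a
    using assms(1) by (simp add: dirichlet_character_def)
  have step: "\<psi> (a + int m * int k) = \<psi> a" for a k
  proof (induction k)
    case (Suc k)
    have "a + int m * int (Suc k) = (a + int m * int k) + int m" by (simp add: algebra_simps)
    then show ?case using Suc by (simp only: per)
  qed simp
  obtain k where k: "b = a + int m * k"
    using assms(2) by (auto simp: cong_iff_lin)
  show ?thesis
  proof (cases "k \<ge> 0")
    case True
    then show ?thesis using step[of a "nat k"] k by simp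
  next
    case False
    then have "a = b + int m * int (nat (- k))" using k by simp
    then show ?thesis using step[of b "nat (- k)"] by simp
  qed
qed

lemma dirichlet_character_one:
  assumes "dirichlet_character m \<psi>"
  shows "\<psi> 1 = 1"
proof -
  have "\<psi> 1 * \<psi> 1 = \<psi> 1" "\<psi> 1 \<noteq> 0"
    using assms unfolding dirichlet_character_def by (metis mult_1, metis coprime_1_left)
  then show ?thesis by simp
qed

lemma dirichlet_character_power:
  assumes "dirichlet_character m \<psi>"
  shows "\<psi> (a ^ n) = \<psi> a ^ n"
  using assms
  by (induction n) (simp_all add: dirichlet_character_one, simp add: dirichlet_character_def)

text \<open>By Euler's theorem the value is a root of unity.\<close>

lemma dirichlet_character_norm:
  assumes \<psi>: "dirichlet_character m \<psi>" and m: "m > 0" and a: "coprime a (int m)"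
  shows "cmod (\<psi> a) = 1"
proof -
  define b where "b = nat (a mod int m)"
  have b: "int b = a mod int m" using m by (simp add: b_def)
  have "coprime (int b) (int m)"
    unfolding b using a m by (simp add: coprime_mod_left_iff)
  then have "coprime b m" by simp
  then have "[b ^ totient m = 1] (mod m)" by (rule euler_theorem)
  then have "[int b ^ totient m = 1] (mod int m)"
    by (metis cong_int_iff of_nat_1 of_nat_power)
  then have "\<psi> (int b ^ totient m) = 1"
    using dirichlet_character_cong[OF \<psi>] dirichlet_character_one[OF \<psi>] by metis
  then have "cmod (\<psi> (int b)) ^ totient m = 1"
    by (simp add: dirichlet_character_power[OF \<psi>] flip: norm_power)
  then have "cmod (\<psi> (int b)) = 1"
    using m by (intro power_eq_imp_eq_base[of _ "totient m" 1]) simp_all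
  moreover have "\<psi> (int b) = \<psi> a"
    by (rule dirichlet_character_cong[OF \<psi>]) (simp add: b)
  ultimately show ?thesis by simp
qed

lemma odd_character_uminus:
  assumes "\<psi> \<in> odd_characters m"
  shows "\<psi> (- a) = - \<psi> a"
proof -
  have "\<psi> (-1 * a) = \<psi> (-1) * \<psi> a"
    using assms unfolding odd_characters_def dirichlet_character_def by blast
  then show ?thesis using assms by (simp add: odd_characters_def)
qed

lemma L_one_odd:
  assumes p: "p > 0" and \<psi>: "\<psi> \<in> odd_characters p"
  shows "L_one \<psi> = of_real (pi / (2 * real p)) *
    (\<Sum>c=1..<p. \<psi> (int c) * of_real (cot (pi * real c / real p)))"
  unfolding L_one_def
  using \<psi> odd_character_uminus[OF \<psi>]
  by (intro suminf_odd_periodic_div p) (auto simp: odd_characters_def dirichlet_character_def)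

section \<open>Orthogonality of the odd characters through primitive roots\<close>

lemma sum_roots_of_unity_power_cnj:
  assumes n: "n > 0"
  shows "(\<Sum>z | z ^ n = 1. z ^ i * cnj z ^ j) = (if [i = j] (mod n) then of_nat n else 0)"
proof -
  have "(\<Sum>z | z ^ n = 1. z ^ i * cnj z ^ j)
      = (\<Sum>k<n. cis (2 * pi * real k / real n) ^ i * cnj (cis (2 * pi * real k / real n)) ^ j)"
    by (rule sum.reindex_bij_betw[OF Complex.bij_betw_roots_unity[OF n], symmetric])
  also have "\<dots> = (\<Sum>k<n. cis (2 * pi * of_int (int i - int j) * real k / real n))"
    by (intro sum.cong refl)
       (simp add: Complex.DeMoivre cis_cnj cis_mult algebra_simps diff_divide_distrib)
  also have "\<dots> = (if int n dvd int i - int j then of_nat n else 0)"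
    by (rule sum_cis_multiples[OF n])
  also have "int n dvd int i - int j \<longleftrightarrow> [i = j] (mod n)"
    by (simp add: cong_iff_dvd_diff flip: cong_int_iff)
  finally show ?thesis .
qed

text \<open>The solutions of \<open>z ^ (2 * m) = 1\<close> split into those with
  \<open>z ^ m = 1\<close> and those with \<open>z ^ m = -1\<close>, so the sum is a difference of
  two sums over roots of unity.\<close>

lemma sum_roots_of_minus_unity_power_cnj:
  assumes m: "m > 0"
  shows "(\<Sum>z | z ^ m = -1. z ^ i * cnj z ^ j)
    = (if [i = j] (mod (2 * m)) then of_nat m else if [i = j] (mod m) then - of_nat m else 0)"
proof -
  have "{z::complex. z ^ (2 * m) = 1} = {z. z ^ m = 1} \<union> {z. z ^ m = -1}"
    by (auto simp: mult.commute[of 2] power_mult power2_eq_1_iff)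
  then have "(\<Sum>z | z ^ (2 * m) = 1. z ^ i * cnj z ^ j)
      = (\<Sum>z | z ^ m = 1. z ^ i * cnj z ^ j) + (\<Sum>z | z ^ m = -1. z ^ i * cnj z ^ j)"
    using m finite_roots_unity[of m, where 'a = complex] finite_nth_roots[of m "-1"]
    by (simp only:, intro sum.union_disjoint) auto
  moreover have "[i = j] (mod (2 * m)) \<Longrightarrow> [i = j] (mod m)"
    by (rule cong_dvd_modulus_nat) auto
  ultimately show ?thesis
    using m by (auto simp: sum_roots_of_unity_power_cnj eq_neg_iff_add_eq_0 add.commute split: if_splits)
qed

text \<open>
  An odd character modulo an odd prime \<open>p\<close> is determined by its value at a primitive root,
  and this value ranges over the solutions of \<open>z ^ ((p - 1) / 2) = -1\<close>.
\<close>
lemma bij_betw_odd_characters: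
  assumes p: "prime p" "odd p" and g: "residue_primroot p g"
  shows "bij_betw (\<lambda>\<psi>. \<psi> (int g)) (odd_characters p) {z. z ^ ((p - 1) div 2) = -1}"
proof -
  define m where "m = (p - 1) div 2"
  have pm: "p - 1 = 2 * m" using p by (auto simp: m_def)
  have p2: "p > 2" using p prime_gt_1_nat[of p] by (cases "p = 2") auto
  have gp: "coprime p g" "ord p g = 2 * m"
    using g p by (simp_all add: residue_primroot_def totient_prime flip: pm)
  have g_cong: "[int g ^ i = int g ^ j] (mod int p) \<longleftrightarrow> [i = j] (mod (2 * m))" for i j
    using order_divides_expdiff[OF gp(1), of i j] gp(2) by (simp flip: cong_int_iff)
  have m0: "m > 0" using pm p2 by simp
  have pp: "prime (int p)" using p by simp
  \<comment> \<open>The power is a square root of 1 modulo the prime \<open>p\<close>, and it is not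
    1 because \<open>g\<close> has order \<open>2 * m\<close>.\<close>
  have gm: "[int g ^ m = -1] (mod int p)"
  proof -
    have "[int g ^ (2 * m) = 1] (mod int p)"
      using g_cong[of "2 * m" 0] by (simp add: cong_0_iff)
    then have "int p dvd (int g ^ m - 1) * (int g ^ m + 1)"
      by (simp add: cong_iff_dvd_diff power_even_eq power2_eq_square square_diff_one_factored[symmetric] ring_distribs)
    moreover have "\<not> int p dvd int g ^ m - 1"
    proof
      assume "int p dvd int g ^ m - 1"
      then have "[int g ^ m = int g ^ 0] (mod int p)" by (simp add: cong_iff_dvd_diff)
      then have "2 * m dvd m" using g_cong[of m 0] by (simp add: cong_0_iff)
      then show False using m0 by (auto dest: dvd_imp_le)
    qed
    ultimately have "int p dvd int g ^ m + 1"
      using pp prime_dvd_mult_iff by blast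
    then show ?thesis by (simp add: cong_iff_dvd_diff)
  qed
  have gen: "\<exists>i. [int g ^ i = a] (mod int p)" if a: "\<not> int p dvd a" for a
  proof -
    define r where "r = nat (a mod int p)"
    have r: "int r = a mod int p" using p2 by (simp add: r_def)
    moreover have "a mod int p \<noteq> 0" using a by (simp add: dvd_eq_mod_eq_0)
    moreover have "a mod int p < int p" using p2 by simp
    ultimately have "r \<noteq> 0" "r < p" by auto
    then have "r \<in> totatives p" using p by (simp add: totatives_prime)
    then obtain i where "r = g ^ i mod p"
      using residue_primroot_is_generator[OF _ g] p2 by (auto simp: bij_betw_def)
    with r have "int (g ^ i mod p) = a mod int p" by simp
    then show ?thesis by (intro exI[of _ i]) (simp add: Cong.cong_def zmod_int)
  qed
  have coprime: "coprime a (int p) \<longleftrightarrow> \<not> int p dvd a" for a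
    using pp prime_imp_coprime[OF pp, of a] by (metis coprime_commute coprime_absorb_left not_prime_unit)
  have inj: "inj_on (\<lambda>\<psi>. \<psi> (int g)) (odd_characters p)"
  proof (rule inj_onI, rule ext)
    fix \<psi> \<theta> a assume "\<psi> \<in> odd_characters p" "\<theta> \<in> odd_characters p" and eq: "\<psi> (int g) = \<theta> (int g)"
    then have d: "dirichlet_character p \<psi>" "dirichlet_character p \<theta>" by (auto simp: odd_characters_def)
    show "\<psi> a = \<theta> a"
    proof (cases "int p dvd a")
      case True
      then have "\<psi> a = 0" "\<theta> a = 0" using d coprime by (auto simp: dirichlet_character_def)
      then show ?thesis by simp
    next
      case False
      then obtain i where "[int g ^ i = a] (mod int p)" using gen by blast
      then show ?thesis
        using dirichlet_character_cong[OF d(1)] dirichlet_character_cong[OF d(2)]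
          dirichlet_character_power[OF d(1)] dirichlet_character_power[OF d(2)] eq by metis
    qed
  qed
  have into: "\<psi> (int g) ^ m = -1" if "\<psi> \<in> odd_characters p" for \<psi>
  proof -
    have \<psi>: "dirichlet_character p \<psi>" and "\<psi> (-1) = -1"
      using that by (auto simp: odd_characters_def)
    then show ?thesis
      using dirichlet_character_cong[OF \<psi> gm] by (simp add: dirichlet_character_power[OF \<psi>])
  qed
  have onto: "z \<in> (\<lambda>\<psi>. \<psi> (int g)) ` odd_characters p" if z: "z ^ m = -1" for z
  proof -
    have z0: "z \<noteq> 0" using z m0 by (auto simp: power_0_left)
    have z2: "z ^ (2 * m) = 1" using z by (simp add: mult.commute[of 2] power_mult)
    \<comment> \<open>A discrete logarithm, determined only modulo \<open>2 * m\<close>; the choice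
      is harmless since \<open>z ^ (2 * m) = 1\<close>.\<close>
    define e where "e a = (SOME i. [int g ^ i = a] (mod int p))" for a
    define \<psi> where "\<psi> a = (if int p dvd a then 0 else z ^ e a)" for a
    have \<psi>: "\<psi> a = z ^ i" if "[int g ^ i = a] (mod int p)" for a i
    proof -
      have "\<not> int p dvd int g ^ i"
        using gp(1) prime_dvd_power[OF pp] p2
        by (metis coprime_absorb_left int_dvd_int_iff not_prime_unit p(1))
      then have a: "\<not> int p dvd a" using that by (simp add: cong_dvd_iff)
      have "[int g ^ e a = a] (mod int p)" unfolding e_def using that by (rule someI)
      then have "[e a = i] (mod (2 * m))" using that g_cong by (metis cong_sym cong_trans)
      then have "e a mod (2 * m) = i mod (2 * m)" by (simp add: Cong.cong_def)
      moreover have "z ^ k = z ^ (k mod (2 * m))" for k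
        by (metis z2 mult_div_mod_eq power_add power_mult power_one mult_1)
      ultimately show ?thesis using a by (metis \<psi>_def)
    qed
    have "dirichlet_character p \<psi>"
      unfolding dirichlet_character_def
    proof (intro conjI allI)
      fix a b
      \<comment> \<open>The predicate under \<open>SOME\<close> depends only on the residue class of
        \<open>a\<close>, so the chosen exponents coincide.\<close>
      show "\<psi> (a + int p) = \<psi> a"
        by (simp add: \<psi>_def e_def Cong.cong_def)
      show "\<psi> (a * b) = \<psi> a * \<psi> b"
      proof (cases "int p dvd a \<or> int p dvd b")
        case True
        then show ?thesis by (auto simp: \<psi>_def)
      next
        case False
        then obtain i j where ij: "[int g ^ i = a] (mod int p)" "[int g ^ j = b] (mod int p)"
          using gen by blast
        then have "[int g ^ (i + j) = a * b] (mod int p)"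
          by (simp add: power_add cong_mult)
        then show ?thesis
          using \<psi>[OF ij(1)] \<psi>[OF ij(2)] \<psi>[of "i + j" "a * b"] by (simp add: power_add)
      qed
      show "(\<psi> a \<noteq> 0) = coprime a (int p)"
        using z0 by (simp add: coprime \<psi>_def)
    qed
    moreover have "\<psi> (-1) = -1" using \<psi>[OF gm] z by simp
    moreover have "\<psi> (int g) = z" using \<psi>[of 1 "int g"] by simp
    ultimately show ?thesis by (auto simp: odd_characters_def)
  qed
  show ?thesis
    unfolding bij_betw_def m_def[symmetric] using inj into onto by blast
qed

text \<open>Let \<open>i\<close> and \<open>j\<close> be discrete logarithms of \<open>c\<close> and
  \<open>d\<close>. The values at the primitive root turn the sum into one over the roots of -1, and
  congruence of \<open>i\<close> and \<open>j\<close> modulo \<open>2 * m\<close> or modulo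
  \<open>m\<close> means that \<open>c\<close> and \<open>d\<close> agree, or agree up to sign,
  modulo \<open>p\<close>.\<close>

lemma odd_characters_orthogonality:
  assumes p: "prime p" "odd p" and c: "c \<in> {1..<p}" and d: "d \<in> {1..<p}"
  shows "(\<Sum>\<psi>\<in>odd_characters p. \<psi> (int c) * cnj (\<psi> (int d)))
    = (of_nat (p - 1) / 2) * ((if d = c then 1 else 0) - (if d = p - c then 1 else 0))"
proof -
  define m where "m = (p - 1) div 2"
  have pm: "p - 1 = 2 * m" using p by (auto simp: m_def)
  have p1: "p > 1" using p prime_gt_1_nat by blast
  obtain g where g: "residue_primroot p g"
    using prime_primitive_root_exists[of p] p p1 by auto
  have gp: "coprime p g" "ord p g = 2 * m"
    using g p by (simp_all add: residue_primroot_def totient_prime flip: pm)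
  have m0: "m > 0" using pm p1 by (cases m) auto
  have "\<exists>i. [g ^ i = a] (mod p)" if "a \<in> {1..<p}" for a
  proof -
    have "a \<in> totatives p" using that p by (auto simp: totatives_prime)
    then obtain i where "a = g ^ i mod p"
      using residue_primroot_is_generator[OF p1 g] by (auto simp: bij_betw_def)
    then show ?thesis by (intro exI[of _ i]) (simp add: Cong.cong_def)
  qed
  then obtain i j where ij: "[g ^ i = c] (mod p)" "[g ^ j = d] (mod p)"
    using c d by metis
  have "[i = j] (mod (2 * m)) \<longleftrightarrow> [c = d] (mod p)"
    using order_divides_expdiff[OF gp(1), of i j] gp(2) ij by (metis cong_sym cong_trans)
  also have "\<dots> \<longleftrightarrow> d = c"
    using c d by (auto simp: Cong.cong_def)
  finally have eq1: "[i = j] (mod (2 * m)) \<longleftrightarrow> d = c" .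
  \<comment> \<open>Doubling the exponents raises the modulus to the order of \<open>g\<close>, so
    the condition becomes one on the squares of \<open>c\<close> and \<open>d\<close>.\<close>
  have "[i = j] (mod m) \<longleftrightarrow> [2 * i = 2 * j] (mod (2 * m))"
    by (simp add: Cong.cong_def mult_mod_right[symmetric])
  also have "\<dots> \<longleftrightarrow> [g ^ (2 * i) = g ^ (2 * j)] (mod p)"
    using order_divides_expdiff[OF gp(1), of "2 * i" "2 * j"] gp(2) by simp
  also have "\<dots> \<longleftrightarrow> [c ^ 2 = d ^ 2] (mod p)"
    using cong_pow[OF ij(1), of 2] cong_pow[OF ij(2), of 2]
    by (metis cong_sym cong_trans mult.commute power_mult)
  also have "\<dots> \<longleftrightarrow> int p dvd (int c - int d) * (int c + int d)"
    by (simp add: cong_iff_dvd_diff power2_eq_square algebra_simps flip: cong_int_iff)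
  also have "\<dots> \<longleftrightarrow> int p dvd int c - int d \<or> p dvd c + d"
    using p by (simp add: prime_dvd_mult_iff flip: of_nat_add)
  also have "int p dvd int c - int d \<longleftrightarrow> d = c"
    using c d by (simp add: cong_int_iff Cong.cong_def flip: cong_iff_dvd_diff) auto
  also have "p dvd c + d \<longleftrightarrow> d = p - c"
  proof
    assume "p dvd c + d"
    then obtain k where k: "c + d = p * k" ..
    have "k = 1"
    proof -
      have "0 < p * k" "p * k < p * 2" unfolding k[symmetric] using c d by auto
      then have "0 < k" "k < 2" by simp_all
      then show ?thesis by simp
    qed
    then show "d = p - c" using k by simp
  qed (use c in simp)
  finally have eq2: "[i = j] (mod m) \<longleftrightarrow> d = c \<or> d = p - c" .
  have "(\<Sum>\<psi>\<in>odd_characters p. \<psi> (int c) * cnj (\<psi> (int d)))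
      = (\<Sum>\<psi>\<in>odd_characters p. \<psi> (int g) ^ i * cnj (\<psi> (int g)) ^ j)"
  proof (intro sum.cong refl)
    fix \<psi> assume "\<psi> \<in> odd_characters p"
    then have \<psi>: "dirichlet_character p \<psi>" by (simp add: odd_characters_def)
    have "\<psi> (int c) = \<psi> (int g ^ i)" "\<psi> (int d) = \<psi> (int g ^ j)"
      using ij[THEN cong_sym] by (intro dirichlet_character_cong[OF \<psi>]; metis cong_int_iff of_nat_power)+
    then show "\<psi> (int c) * cnj (\<psi> (int d)) = \<psi> (int g) ^ i * cnj (\<psi> (int g)) ^ j"
      by (simp add: dirichlet_character_power[OF \<psi>])
  qed
  also have "\<dots> = (\<Sum>z | z ^ m = -1. z ^ i * cnj z ^ j)"
    using sum.reindex_bij_betw[OF bij_betw_odd_characters[OF p g]] by (simp only: m_def)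
  also have "\<dots> = of_nat m * ((if d = c then 1 else 0) - (if d = p - c then 1 else 0))"
  proof -
    \<comment> \<open>As \<open>p\<close> is odd, the two indicators never overlap.\<close>
    have "p - c \<noteq> c"
    proof
      assume "p - c = c"
      then have "p = 2 * c" using c by simp
      then show False using p by simp
    qed
    then show ?thesis unfolding sum_roots_of_minus_unity_power_cnj[OF m0] eq1 eq2 by auto
  qed
  finally show ?thesis unfolding pm by simp
qed

section \<open>Reduction of the moment to a cotangent sum\<close>

lemma bij_betw_nat_remainders_mult:
  fixes q p :: nat
  assumes "coprime p q"
  shows "bij_betw (\<lambda>c. q * c mod p) {1..<p} {1..<p}"
proof -
  have "inj_on (\<lambda>c. q * c mod p) {1..<p}"
  proof (rule inj_onI)
    fix c d assume cd: "c \<in> {1..<p}" "d \<in> {1..<p}" "q * c mod p = q * d mod p"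
    then have "[q * c = q * d] (mod p)" unfolding Cong.cong_def by blast
    then have "[c = d] (mod p)"
      using assms by (simp add: cong_mult_lcancel_nat coprime_commute)
    then show "c = d" using cd by (simp add: Cong.cong_def)
  qed
  moreover have "(\<lambda>c. q * c mod p) ` {1..<p} \<subseteq> {1..<p}"
  proof safe
    fix c assume c: "c \<in> {1..<p}"
    then have "\<not> p dvd q * c"
      using assms by (auto simp: coprime_dvd_mult_right_iff dest: dvd_imp_le)
    then show "q * c mod p \<in> {1..<p}" using c by (auto simp: dvd_eq_mod_eq_0)
  qed
  ultimately show ?thesis
    unfolding bij_betw_def by (simp add: endo_inj_surj)
qed

text \<open>Moves the twist from the character into the cotangent: replacing \<open>c\<close> by
  \<open>q * c\<close> pulls out \<open>\<psi> (int q)\<close>, which its conjugate cancels because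
  it has modulus 1.\<close>

lemma cnj_character_mult_sum_cot:
  assumes \<psi>: "dirichlet_character p \<psi>" and p: "p > 0" "coprime p q"
  shows "cnj (\<psi> (int q)) * (\<Sum>c=1..<p. \<psi> (int c) * of_real (cot (pi * real c / real p)))
    = (\<Sum>c=1..<p. \<psi> (int c) * of_real (cot (real q * (pi * real c / real p))))"
proof -
  have "(\<Sum>c=1..<p. \<psi> (int c) * of_real (cot (pi * real c / real p)))
      = (\<Sum>c=1..<p. \<psi> (int (q * c mod p)) * of_real (cot (pi * real (q * c mod p) / real p)))"
    by (rule sum.reindex_bij_betw[OF bij_betw_nat_remainders_mult[OF p(2)], symmetric])
  also have "\<dots> = (\<Sum>c=1..<p. \<psi> (int q) * (\<psi> (int c) * of_real (cot (real q * (pi * real c / real p)))))"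
  proof (intro sum.cong refl)
    fix c
    have "\<psi> (int (q * c mod p)) = \<psi> (int q * int c)"
      by (rule dirichlet_character_cong[OF \<psi>]) (simp add: zmod_int)
    moreover have "\<psi> (int q * int c) = \<psi> (int q) * \<psi> (int c)"
      using \<psi> by (simp add: dirichlet_character_def)
    moreover have "cot (pi * real (q * c mod p) / real p) = cot (real q * (pi * real c / real p))"
    proof -
      have "real (q * c) = real p * real (q * c div p) + real (q * c mod p)"
        by (metis mult_div_mod_eq of_nat_add of_nat_mult)
      then have "real q * (pi * real c / real p)
          = pi * real (q * c mod p) / real p + pi * of_int (int (q * c div p))"
        using p by (simp add: field_simps)
      then show ?thesis by (simp only: cot_add_int_pi)
    qed
    ultimately show "\<psi> (int (q * c mod p)) * of_real (cot (pi * real (q * c mod p) / real p))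
        = \<psi> (int q) * (\<psi> (int c) * of_real (cot (real q * (pi * real c / real p))))"
      by simp
  qed
  finally have "(\<Sum>c=1..<p. \<psi> (int c) * of_real (cot (pi * real c / real p)))
      = \<psi> (int q) * (\<Sum>c=1..<p. \<psi> (int c) * of_real (cot (real q * (pi * real c / real p))))"
    by (simp add: sum_distrib_left)
  moreover have "cnj (\<psi> (int q)) * \<psi> (int q) = 1"
    using dirichlet_character_norm[OF \<psi> p(1), of "int q"] p(2)
    by (simp add: coprime_commute mult.commute complex_norm_square[symmetric])
  ultimately show ?thesis by (simp add: mult.assoc[symmetric])
qed

lemma twisted_moment_eq_cot_sum:
  assumes p: "prime p" "odd p" and q: "coprime p q1" "coprime p q2"
  shows "twisted_moment q1 q2 p = of_real (pi\<^sup>2 / (2 * (real p)\<^sup>2) *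
    (\<Sum>c=1..<p. cot (real q1 * (pi * real c / real p)) * cot (real q2 * (pi * real c / real p))))"
proof -
  define t where "t q c = cot (real q * (pi * real c / real p))" for q c :: nat
  define S where "S = (\<Sum>c=1..<p. t q2 c * t q1 c)"
  have p1: "p > 1" using p prime_gt_1_nat by blast
  then have p0: "p > 0" by simp
  have t_refl: "t q (p - c) = - t q c" if "c \<in> {1..<p}" for q c
  proof -
    have "real q * (pi * real (p - c) / real p) = - (real q * (pi * real c / real p)) + pi * of_int (int q)"
      using that by (simp add: of_nat_diff field_simps)
    then show ?thesis unfolding t_def by (simp only: cot_add_int_pi cot_minus)
  qed
  have each: "\<psi> (int q1) * cnj (\<psi> (int q2)) * of_real ((cmod (L_one \<psi>))\<^sup>2)
      = of_real ((pi / (2 * real p))\<^sup>2) *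
        (\<Sum>c=1..<p. \<Sum>d=1..<p. of_real (t q2 c * t q1 d) * (\<psi> (int c) * cnj (\<psi> (int d))))"
    if odd: "\<psi> \<in> odd_characters p" for \<psi>
  proof -
    have \<psi>: "dirichlet_character p \<psi>" using odd by (simp add: odd_characters_def)
    define C where "C = (\<Sum>c=1..<p. \<psi> (int c) * of_real (cot (pi * real c / real p)))"
    have "\<psi> (int q1) * cnj (\<psi> (int q2)) * of_real ((cmod (L_one \<psi>))\<^sup>2)
        = \<psi> (int q1) * cnj (\<psi> (int q2)) * (L_one \<psi> * cnj (L_one \<psi>))"
      by (simp only: complex_norm_square)
    \<comment> \<open>One twisting factor goes to each copy of the cotangent sum, so that
      \<open>cnj_character_mult_sum_cot\<close> absorbs both.\<close>
    also have "\<dots> = of_real ((pi / (2 * real p))\<^sup>2) *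
        ((cnj (\<psi> (int q2)) * C) * cnj (cnj (\<psi> (int q1)) * C))"
      unfolding L_one_odd[OF p0 odd] C_def[symmetric] by (simp add: power2_eq_square)
    also have "(cnj (\<psi> (int q2)) * C) * cnj (cnj (\<psi> (int q1)) * C)
        = (\<Sum>c=1..<p. \<psi> (int c) * of_real (t q2 c)) * (\<Sum>d=1..<p. cnj (\<psi> (int d)) * of_real (t q1 d))"
      unfolding C_def cnj_character_mult_sum_cot[OF \<psi> p0 q(1)] cnj_character_mult_sum_cot[OF \<psi> p0 q(2)]
      by (simp add: t_def)
    also have "\<dots> = (\<Sum>c=1..<p. \<Sum>d=1..<p. of_real (t q2 c * t q1 d) * (\<psi> (int c) * cnj (\<psi> (int d))))"
      by (simp add: sum_product mult_ac)
    finally show ?thesis .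
  qed
  have "(\<Sum>\<psi>\<in>odd_characters p. \<Sum>c=1..<p. \<Sum>d=1..<p. of_real (t q2 c * t q1 d) * (\<psi> (int c) * cnj (\<psi> (int d))))
      = (\<Sum>c=1..<p. \<Sum>d=1..<p. of_real (t q2 c * t q1 d) *
          (\<Sum>\<psi>\<in>odd_characters p. \<psi> (int c) * cnj (\<psi> (int d))))"
    unfolding sum_distrib_left by (rule trans[OF sum.swap], rule sum.cong[OF refl], rule sum.swap)
  also have "\<dots> = (\<Sum>c=1..<p. \<Sum>d=1..<p. of_nat (p - 1) / 2 *
      ((if d = c then of_real (t q2 c * t q1 c) else 0)
       - (if d = p - c then of_real (t q2 c * t q1 (p - c)) else 0)))"
    by (intro sum.cong refl) (simp add: odd_characters_orthogonality[OF p])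
  \<comment> \<open>The term \<open>d = p - c\<close> carries a minus sign, but \<open>t q1\<close>
    is odd under this reflection, so it doubles the term \<open>d = c\<close>.\<close>
  also have "\<dots> = (\<Sum>c=1..<p. of_nat (p - 1) / 2 * of_real (2 * (t q2 c * t q1 c)))"
  proof (intro sum.cong refl)
    fix c assume c: "c \<in> {1..<p}"
    then have "p - c \<in> {1..<p}" by auto
    then show "(\<Sum>d=1..<p. of_nat (p - 1) / 2 *
        ((if d = c then of_real (t q2 c * t q1 c) else 0)
         - (if d = p - c then of_real (t q2 c * t q1 (p - c)) else 0)))
        = complex_of_nat (p - 1) / 2 * of_real (2 * (t q2 c * t q1 c))"
      using c unfolding sum_distrib_left[symmetric] sum_subtractf t_refl[OF c]
      by simp
  qed
  also have "\<dots> = of_nat (p - 1) * of_real S"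
    by (simp add: S_def sum_distrib_left)
  finally have sum: "(\<Sum>\<psi>\<in>odd_characters p. \<Sum>c=1..<p. \<Sum>d=1..<p.
      of_real (t q2 c * t q1 d) * (\<psi> (int c) * cnj (\<psi> (int d)))) = of_nat (p - 1) * of_real S" .
  have "twisted_moment q1 q2 p
      = 2 / of_nat (p - 1) * (of_real ((pi / (2 * real p))\<^sup>2) * (of_nat (p - 1) * of_real S))"
    unfolding twisted_moment_def totient_prime[OF p(1)] sum[symmetric] sum_distrib_left[of "of_real _" _ "odd_characters p"]
    by (simp only: each cong: sum.cong)
  also have "\<dots> = of_real (pi\<^sup>2 / (2 * (real p)\<^sup>2) * S)"
    using p1 by (simp add: power2_eq_square field_simps)
  finally show ?thesis
    by (simp add: S_def t_def mult.commute)
qed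

section \<open>From the cotangent sum to the asymptotic formula along the primes\<close>

theorem theorem3p4:
  fixes q1 q2 :: nat
  assumes "q1 \<ge> 1" and "q2 \<ge> 1" and "coprime q1 q2"
  shows "(\<lambda>p. twisted_moment q1 q2 p - of_real (pi\<^sup>2 / (6 * real q1 * real q2)))
           \<in> O[inf at_top (principal {p. prime p})](\<lambda>p. 1 / of_nat p)"
proof -
  obtain C where C: "\<And>p. p > 0 \<Longrightarrow> coprime p q1 \<Longrightarrow> coprime p q2 \<Longrightarrow>
    \<bar>(\<Sum>c=1..<p. cot (real q1 * (pi * real c / real p)) * cot (real q2 * (pi * real c / real p)))
      - (real p)\<^sup>2 / (3 * real q1 * real q2)\<bar> \<le> C * real p"
    using sum_cot_mult_cot_asymp[of q1 q2] assms by auto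
  \<comment> \<open>Beyond this threshold \<open>p\<close> is odd and exceeds both \<open>q1\<close>
    and \<open>q2\<close>, hence is coprime to them.\<close>
  have bound: "cmod (twisted_moment q1 q2 p - of_real (pi\<^sup>2 / (6 * real q1 * real q2)))
      \<le> pi\<^sup>2 / 2 * C * cmod (1 / of_nat p)" if p: "prime p" "p > q1 + q2 + 2" for p
  proof -
    have p0: "p > 0" using p by simp
    have odd: "odd p" using p prime_odd_nat[of p] by simp
    have cop: "coprime p q" if "0 < q" "q < p" for q
      using that p by (intro prime_imp_coprime) (auto dest: dvd_imp_le)
    have q: "coprime p q1" "coprime p q2"
      using cop[of q1] cop[of q2] assms p by auto
    define S where "S = (\<Sum>c=1..<p. cot (real q1 * (pi * real c / real p)) * cot (real q2 * (pi * real c / real p)))"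
    \<comment> \<open>Scaling by \<open>pi\<^sup>2 / (2 * p\<^sup>2)\<close> turns the main term of
      the cotangent sum into the claimed constant and its error \<open>C * p\<close> into a multiple
      of \<open>1 / p\<close>.\<close>
    have "pi\<^sup>2 / (2 * (real p)\<^sup>2) * S - pi\<^sup>2 / (6 * real q1 * real q2)
        = pi\<^sup>2 / (2 * (real p)\<^sup>2) * (S - (real p)\<^sup>2 / (3 * real q1 * real q2))"
      using p0 assms by (simp add: field_simps)
    then have "cmod (twisted_moment q1 q2 p - of_real (pi\<^sup>2 / (6 * real q1 * real q2)))
        = \<bar>pi\<^sup>2 / (2 * (real p)\<^sup>2) * (S - (real p)\<^sup>2 / (3 * real q1 * real q2))\<bar>"
      unfolding twisted_moment_eq_cot_sum[OF p(1) odd q] S_def[symmetric]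
      by (simp only: norm_of_real flip: of_real_diff)
    also have "\<dots> = pi\<^sup>2 / (2 * (real p)\<^sup>2) * \<bar>S - (real p)\<^sup>2 / (3 * real q1 * real q2)\<bar>"
      by (simp only: abs_mult) simp
    also have "\<dots> \<le> pi\<^sup>2 / (2 * (real p)\<^sup>2) * (C * real p)"
      unfolding S_def by (intro mult_left_mono C p0 q) simp
    also have "\<dots> = pi\<^sup>2 / 2 * C * cmod (1 / of_nat p)"
      using p0 by (simp add: norm_divide power2_eq_square)
    finally show ?thesis .
  qed
  show ?thesis
  proof (rule bigoI)
    show "\<forall>\<^sub>F p in inf at_top (principal {p. prime p}).
        cmod (twisted_moment q1 q2 p - of_real (pi\<^sup>2 / (6 * real q1 * real q2)))
        \<le> pi\<^sup>2 / 2 * C * cmod (1 / of_nat p)"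
      unfolding eventually_inf_principal
      using eventually_gt_at_top[of "q1 + q2 + 2"] by eventually_elim (use bound in blast)
  qed
qed

end
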